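(* Let $(G=(V,E,w),\sigma)$ be a connected connection graph, with $\sigma$ taking values in $\mathbb{O}(d)$. Then there exists a switching function $\tau:V\to\mathbb{O}(d)$ for which $\mathcal{P}_d(V)$ is a feasible collection for the $\tau$-switched connection graph $(G,\sigma^\tau)$.
   Context: $G=(V,E,w)$ is a finite, connected, weighted, undirected graph with $V=\{1,\dots,n\}$, $n\ge 2$, $E\subseteq\binom{V}{2}$, $|E|=m\ge1$, and symmetric weights $w_{ij}\ge 0$ with $w_{ij}>0$ iff $\{i,j\}\in E$ (written $i\sim j$). The index-oriented edge set is $E'=\{(i,j): i<j,\ i\sim j\}$, and $w(e)=w_{ij}$ for $e=(i,j)\in E'$. $\mathbb{O}(d)$ is the group of $d\times d$ real orthogonal matrices, $d\ge1$. A connection is a map $\sigma:E'\to\mathbb{O}(d)$, written $\sigma_{ij}=\sigma((i,j))$, extended by $\sigma_{ji}=\sigma_{ij}^{-1}=\sigma_{ij}^\top$; the pair $(G,\sigma)$ is a connection graph. For $\tau:V\to\mathbb{O}(d)$, the $\tau$-switched connection is $\sigma^\tau_{ij}=\tau(i)^{-1}\sigma_{ij}\tau(j)$. $\ell(V;\mathbb{R}^d)$ and $\ell(E';\mathbb{R}^d)$ are the spaces of functions $V\to\mathbb{R}^d$ and $E'\to\mathbb{R}^d$, identified with column vectors in $\mathbb{R}^{nd}$ and $\mathbb{R}^{md}$. For a connection $\rho$ on $G$, the connection incidence matrix $B^\rho\in\mathbb{R}^{nd\times md}$ is the block matrix with $d\times d$ blocks, for $i\in V$, $e\in E'$: $B^\rho_{ie}=I_d$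 if $e=(i,\cdot)$, $B^\rho_{ie}=-\rho_e^\top$ if $e=(\cdot,i)$, and $B^\rho_{ie}=0$ otherwise. Define $\mathcal{W}_1^\rho(\alpha,\beta)=\inf_{J\in\ell(E';\mathbb{R}^d)}\{\sum_{e\in E'}w(e)\|J(e)\|_2 : B^\rho J=\alpha-\beta\}$, with infimum over the empty set equal to $+\infty$. A set $\mathcal{C}\subseteq\ell(V;\mathbb{R}^d)$ is a feasible collection for $(G,\rho)$ if $\mathcal{W}_1^\rho(\alpha,\beta)<\infty$ for all $\alpha,\beta\in\mathcal{C}$. $\mathcal{P}_d(V)$ is the set of vector-valued probability densities: functions $\alpha\in\ell(V;\mathbb{R}^d)$ with $\alpha(i)_\ell\ge0$ for each $i\in V$, $1\le\ell\le d$, and $\sum_{i\in V}\alpha(i)=\mathbf{1}_d=[1,\dots,1]^\top$. *)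

theory Defs
  imports "HOL-Analysis.Analysis"
begin

text \<open>
  The vertex set is \<open>{1..n}\<close>, the index-oriented edge set \<open>E'\<close> of the mathematics is
  \<open>oriented_edges E\<close>, and \<open>\<real>\<^sup>d\<close> is \<open>real ^ 'd\<close>, so that \<open>d = CARD('d)\<close>.
  A function on a finite set \<open>A\<close> is an element of an extensional function space
  \<open>A \<rightarrow>\<^sub>E B\<close>, so values outside \<open>A\<close> carry no information.
\<close>

definition connected_weighted_graph ::
  "nat \<Rightarrow> nat set set \<Rightarrow> (nat \<Rightarrow> nat \<Rightarrow> real) \<Rightarrow> bool" where
  "connected_weighted_graph n E w \<longleftrightarrow>
     n \<ge> 2 \<and>
     E \<subseteq> {e. e \<subseteq> {1..n} \<and> card e = 2} \<and>
     card E \<ge> 1 \<and>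
     (\<forall>i\<in>{1..n}. \<forall>j\<in>{1..n}. w i j \<ge> 0 \<and> w i j = w j i \<and> (w i j > 0 \<longleftrightarrow> {i, j} \<in> E)) \<and>
     (\<forall>i\<in>{1..n}. \<forall>j\<in>{1..n}. (i, j) \<in> {(k, l). {k, l} \<in> E}\<^sup>*)"

definition oriented_edges :: "nat set set \<Rightarrow> (nat \<times> nat) set" where
  "oriented_edges E = {(i, j). i < j \<and> {i, j} \<in> E}"

definition orthogonal_group :: "(real ^ 'd ^ 'd) set" where
  "orthogonal_group = {Q. orthogonal_matrix Q}"

text \<open>Only the values \<open>\<sigma>\<^sub>i\<^sub>j\<close> with \<open>i < j\<close> are stored. The values
  \<open>\<sigma>\<^sub>j\<^sub>i = \<sigma>\<^sub>i\<^sub>j\<^sup>T\<close> on reversed edges are determined by them, and the incidence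
  matrix below refers to oriented edges only.\<close>

definition connections :: "nat set set \<Rightarrow> (nat \<times> nat \<Rightarrow> real ^ 'd ^ 'd) set" where
  "connections E = oriented_edges E \<rightarrow>\<^sub>E orthogonal_group"

definition switching_functions :: "nat \<Rightarrow> (nat \<Rightarrow> real ^ 'd ^ 'd) set" where
  "switching_functions n = {1..n} \<rightarrow>\<^sub>E orthogonal_group"

definition switched ::
  "nat set set \<Rightarrow> (nat \<Rightarrow> real ^ 'd ^ 'd) \<Rightarrow> (nat \<times> nat \<Rightarrow> real ^ 'd ^ 'd)
     \<Rightarrow> (nat \<times> nat \<Rightarrow> real ^ 'd ^ 'd)" where
  "switched E \<tau> \<sigma> =
     (\<lambda>(i, j)\<in>oriented_edges E. matrix_inv (\<tau> i) ** \<sigma> (i, j) ** \<tau> j)"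

definition vector_functions :: "'a set \<Rightarrow> ('a \<Rightarrow> real ^ 'd) set" where
  "vector_functions A = A \<rightarrow>\<^sub>E UNIV"

definition incidence_block ::
  "(nat \<times> nat \<Rightarrow> real ^ 'd ^ 'd) \<Rightarrow> nat \<Rightarrow> nat \<times> nat \<Rightarrow> real ^ 'd ^ 'd" where
  "incidence_block \<rho> i e =
     (if fst e = i then mat 1 else if snd e = i then - transpose (\<rho> e) else 0)"

text \<open>The product \<open>B\<^sup>\<rho> J\<close> of the block matrix with a block column vector.\<close>

definition incidence_mult ::
  "nat \<Rightarrow> nat set set \<Rightarrow> (nat \<times> nat \<Rightarrow> real ^ 'd ^ 'd) \<Rightarrow> (nat \<times> nat \<Rightarrow> real ^ 'd)
     \<Rightarrow> (nat \<Rightarrow> real ^ 'd)" where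
  "incidence_mult n E \<rho> J =
     (\<lambda>i\<in>{1..n}. \<Sum>e\<in>oriented_edges E. incidence_block \<rho> i e *v J e)"

text \<open>In \<open>ereal\<close> the infimum of the empty set is \<open>\<infinity>\<close>.\<close>

definition W1 ::
  "nat \<Rightarrow> nat set set \<Rightarrow> (nat \<Rightarrow> nat \<Rightarrow> real) \<Rightarrow> (nat \<times> nat \<Rightarrow> real ^ 'd ^ 'd)
     \<Rightarrow> (nat \<Rightarrow> real ^ 'd) \<Rightarrow> (nat \<Rightarrow> real ^ 'd) \<Rightarrow> ereal" where
  "W1 n E w \<rho> \<alpha> \<beta> =
     (INF J \<in> {J \<in> vector_functions (oriented_edges E).
                 \<forall>i\<in>{1..n}. incidence_mult n E \<rho> J i = \<alpha> i - \<beta> i}.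
        ereal (\<Sum>(i, j)\<in>oriented_edges E. w i j * norm (J (i, j))))"

definition feasible_collection ::
  "nat \<Rightarrow> nat set set \<Rightarrow> (nat \<Rightarrow> nat \<Rightarrow> real) \<Rightarrow> (nat \<times> nat \<Rightarrow> real ^ 'd ^ 'd)
     \<Rightarrow> (nat \<Rightarrow> real ^ 'd) set \<Rightarrow> bool" where
  "feasible_collection n E w \<rho> C \<longleftrightarrow>
     C \<subseteq> vector_functions {1..n} \<and> (\<forall>\<alpha>\<in>C. \<forall>\<beta>\<in>C. W1 n E w \<rho> \<alpha> \<beta> < \<infinity>)"

definition vector_densities :: "nat \<Rightarrow> (nat \<Rightarrow> real ^ 'd) set" where
  "vector_densities n =
     {\<alpha> \<in> vector_functions {1..n}.
        (\<forall>i\<in>{1..n}. \<forall>l. \<alpha> i $ l \<ge> 0) \<and> (\<Sum>i\<in>{1..n}. \<alpha> i) = (\<chi> l. 1)}"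

lemma orthogonal_matrix_matrix_inv:
  fixes Q :: "real ^ 'd ^ 'd"
  assumes "orthogonal_matrix Q"
  shows "matrix_inv Q = transpose Q"
proof -
  have 1: "transpose Q ** Q = mat 1" "Q ** transpose Q = mat 1"
    using assms by (auto simp: orthogonal_matrix_def)
  then have "Q ** matrix_inv Q = mat 1 \<and> matrix_inv Q ** Q = mat 1"
    unfolding matrix_inv_def
    using someI[of "\<lambda>A. Q ** A = mat 1 \<and> A ** Q = mat 1" "transpose Q"] by blast
  then have "transpose Q ** (Q ** matrix_inv Q) = transpose Q"
    by simp
  then show ?thesis
    using 1 by (simp add: matrix_mul_assoc)
qed

lemma switched_in_connections:
  assumes "connected_weighted_graph n E w" "\<sigma> \<in> connections E" "\<tau> \<in> switching_functions n"
  shows "switched E \<tau> \<sigma> \<in> connections E"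
proof -
  have "matrix_inv (\<tau> i) ** \<sigma> (i, j) ** \<tau> j \<in> orthogonal_group"
    if ij: "(i, j) \<in> oriented_edges E" for i j
  proof -
    have "{i, j} \<subseteq> {1..n}"
      using ij assms(1) unfolding oriented_edges_def connected_weighted_graph_def by blast
    then have "orthogonal_matrix (\<tau> i)" "orthogonal_matrix (\<tau> j)"
      using assms(3) by (auto simp: switching_functions_def orthogonal_group_def PiE_iff)
    moreover have "orthogonal_matrix (\<sigma> (i, j))"
      using ij assms(2) by (auto simp: connections_def orthogonal_group_def PiE_iff)
    ultimately show ?thesis
      by (simp add: orthogonal_group_def orthogonal_matrix_matrix_inv orthogonal_matrix_mul)
  qed
  then show ?thesis
    by (auto simp: switched_def connections_def)
qed

end

(* Switching along a spanning tree makes the connection trivial on every tree edge, and on such an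
   edge the incidence matrix acts as the ordinary scalar one, componentwise. So J can be supported
   on the tree: mass x is moved between any vertex and a root along tree edges, and two densities
   differ by a function whose total sum is zero, so the contributions at the root cancel. *)
theory Submission imports Defs begin

text \<open>The good edges found here contain a spanning tree; the set \<open>S\<close> in the induction
  is the part of the tree grown so far.\<close>

lemma gauge_along_spanning_tree:
  fixes P :: "'a \<Rightarrow> 'a \<Rightarrow> 'b \<Rightarrow> 'b \<Rightarrow> bool"
  assumes "finite V" "v\<^sub>0 \<in> V" and r: "r \<subseteq> V \<times> V"
    and reach: "\<And>a. a \<in> V \<Longrightarrow> (v\<^sub>0, a) \<in> r\<^sup>*"
    and "x\<^sub>0 \<in> X"
    and ext: "\<And>k l x. (k, l) \<in> r \<Longrightarrow> x \<in> X \<Longrightarrow> \<exists>y\<in>X. P k l x y"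
  shows "\<exists>\<tau>. (\<forall>a. \<tau> a \<in> X) \<and> (\<forall>a\<in>V. (v\<^sub>0, a) \<in> {(k, l). (k, l) \<in> r \<and> P k l (\<tau> k) (\<tau> l)}\<^sup>*)"
proof -
  \<comment> \<open>Both endpoints must lie in \<open>S\<close>, so changing \<open>\<tau>\<close>
    outside \<open>S\<close> keeps every pair already in \<open>F S \<tau>\<close>.\<close>
  define F where "F S \<tau> = {(k, l). (k, l) \<in> r \<and> k \<in> S \<and> l \<in> S \<and> P k l (\<tau> k) (\<tau> l)}" for S \<tau>
  have "\<exists>S \<tau>. S \<subseteq> V \<and> v\<^sub>0 \<in> S \<and> card S = Suc m \<and> (\<forall>a. \<tau> a \<in> X) \<and> (\<forall>a\<in>S. (v\<^sub>0, a) \<in> (F S \<tau>)\<^sup>*)"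
    if "m < card V" for m
    using that
  proof (induction m)
    case 0
    show ?case
      using assms(2,5) by (intro exI[of _ "{v\<^sub>0}"] exI[of _ "\<lambda>_. x\<^sub>0"]) auto
  next
    case (Suc m)
    then obtain S \<tau> where S: "S \<subseteq> V" "v\<^sub>0 \<in> S" "card S = Suc m" "\<forall>a. \<tau> a \<in> X"
      and path: "\<forall>a\<in>S. (v\<^sub>0, a) \<in> (F S \<tau>)\<^sup>*"
      by auto
    have "finite S"
      using S(1) assms(1) finite_subset by blast
    obtain b where b: "b \<in> V" "b \<notin> S"
      using Suc.prems S by (metis less_irrefl subset_antisym subsetI)
    \<comment> \<open>A path in \<open>r\<close> from \<open>v\<^sub>0\<close> to the missed vertex
      \<open>b\<close> has to leave \<open>S\<close> somewhere.\<close>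
    have "\<exists>k l. (k, l) \<in> r \<and> k \<in> S \<and> l \<notin> S"
    proof (rule ccontr)
      assume no_crossing: "\<not> ?thesis"
      have "b \<in> S"
        using reach[OF b(1)] by (induction rule: rtrancl_induct) (use S no_crossing in auto)
      with b show False by simp
    qed
    then obtain k l where kl: "(k, l) \<in> r" "k \<in> S" "l \<notin> S" by blast
    \<comment> \<open>The value at \<open>k\<close> is already fixed, so the constraint is solved
      for the value at the new vertex \<open>l\<close>.\<close>
    obtain y where y: "y \<in> X" "P k l (\<tau> k) y"
      using ext[OF kl(1)] S(4) by blast
    let ?\<tau> = "\<tau>(l := y)"
    have mono: "(F S \<tau>)\<^sup>* \<subseteq> (F (insert l S) ?\<tau>)\<^sup>*"
      by (rule rtrancl_mono) (use kl in \<open>auto simp: F_def\<close>)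
    have "(k, l) \<in> F (insert l S) ?\<tau>"
      using kl y by (auto simp: F_def)
    then have "(v\<^sub>0, l) \<in> (F (insert l S) ?\<tau>)\<^sup>*"
      using path kl mono by (meson rtrancl.rtrancl_into_rtrancl subsetD)
    then have "\<forall>a\<in>insert l S. (v\<^sub>0, a) \<in> (F (insert l S) ?\<tau>)\<^sup>*"
      using path mono by blast
    moreover have "insert l S \<subseteq> V" "v\<^sub>0 \<in> insert l S" "card (insert l S) = Suc (Suc m)"
      "\<forall>a. ?\<tau> a \<in> X"
      using S kl y r \<open>finite S\<close> by auto
    ultimately show ?case by blast
  qed
  \<comment> \<open>Growth starts from one vertex, so \<open>card V - 1\<close> further vertices
    exhaust \<open>V\<close>.\<close>
  from this[of "card V - 1"] obtain S \<tau> where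
    "S \<subseteq> V" "card S = card V" and \<tau>: "\<forall>a. \<tau> a \<in> X" "\<forall>a\<in>S. (v\<^sub>0, a) \<in> (F S \<tau>)\<^sup>*"
    using assms(1,2) card_gt_0_iff[of V] by auto
  then have "S = V"
    using assms(1) card_subset_eq by blast
  have "(F S \<tau>)\<^sup>* \<subseteq> {(k, l). (k, l) \<in> r \<and> P k l (\<tau> k) (\<tau> l)}\<^sup>*"
    by (rule rtrancl_mono) (auto simp: F_def)
  with \<tau> \<open>S = V\<close> show ?thesis by blast
qed

definition flat_edge ::
  "nat set set \<Rightarrow> (nat \<times> nat \<Rightarrow> real ^ 'd ^ 'd) \<Rightarrow> nat \<Rightarrow> nat \<Rightarrow> bool" where
  "flat_edge E \<rho> k l \<longleftrightarrow>
     (k, l) \<in> oriented_edges E \<and> \<rho> (k, l) = mat 1 \<or>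
     (l, k) \<in> oriented_edges E \<and> \<rho> (l, k) = mat 1"

text \<open>This is \<open>incidence_mult\<close> without the cutoff to \<open>{1..n}\<close>, so
  that linearity and the flow identities hold at every index \<open>i\<close>.\<close>

definition divergence ::
  "nat set set \<Rightarrow> (nat \<times> nat \<Rightarrow> real ^ 'd ^ 'd) \<Rightarrow> (nat \<times> nat \<Rightarrow> real ^ 'd) \<Rightarrow> nat \<Rightarrow> real ^ 'd" where
  "divergence E \<rho> J i = (\<Sum>e\<in>oriented_edges E. incidence_block \<rho> i e *v J e)"

lemma divergence_add:
  "divergence E \<rho> (\<lambda>e. J e + K e) i = divergence E \<rho> J i + divergence E \<rho> K i"
  by (simp add: divergence_def matrix_vector_right_distrib sum.distrib)

lemma divergence_zero: "divergence E \<rho> (\<lambda>e. 0) i = 0"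
  by (simp add: divergence_def)

lemma divergence_sum:
  "divergence E \<rho> (\<lambda>e. \<Sum>a\<in>A. J a e) i = (\<Sum>a\<in>A. divergence E \<rho> (J a) i)"
  by (induction A rule: infinite_finite_induct) (simp_all add: divergence_add divergence_zero)

text \<open>With trivial transport, the block column of the edge has \<open>mat 1\<close> at the
  tail and \<open>- mat 1\<close> at the head, as in the scalar incidence matrix.\<close>

lemma divergence_point_mass:
  assumes "finite (oriented_edges E)" "(k, l) \<in> oriented_edges E" "\<rho> (k, l) = mat 1"
  shows "divergence E \<rho> (\<lambda>e. if e = (k, l) then x else 0) i
         = (if i = k then x else 0) - (if i = l then x else 0)"
proof -
  have "k \<noteq> l"
    using assms(2) by (auto simp: oriented_edges_def)
  have "divergence E \<rho> (\<lambda>e. if e = (k, l) then x else 0) i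
      = (\<Sum>e\<in>oriented_edges E. if e = (k, l) then incidence_block \<rho> i (k, l) *v x else 0)"
    unfolding divergence_def by (rule sum.cong) auto
  also have "\<dots> = incidence_block \<rho> i (k, l) *v x"
    using assms by simp
  also have "\<dots> = (if i = k then x else 0) - (if i = l then x else 0)"
    using assms(3) \<open>k \<noteq> l\<close> matrix_vector_mult_diff_rdistrib[of 0 "mat 1" x]
    by (auto simp: incidence_block_def transpose_mat)
  finally show ?thesis .
qed

text \<open>A copy of \<open>x\<close> is sent along each edge of the path. What enters an
  intermediate vertex leaves it again, so the divergences telescope to the two ends.\<close>

lemma flat_path_flow:
  assumes fin: "finite (oriented_edges E)"
    and "(k, l) \<in> {(k, l). flat_edge E \<rho> k l}\<^sup>*"
  shows "\<exists>J. \<forall>i. divergence E \<rho> J i = (if i = k then x else 0) - (if i = l then x else 0)"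
  using assms(2)
proof (induction rule: rtrancl_induct)
  case base
  show ?case
    by (rule exI[of _ "\<lambda>e. 0"]) (simp add: divergence_zero)
next
  case (step a b)
  then obtain J where
    J: "\<And>i. divergence E \<rho> J i = (if i = k then x else 0) - (if i = a then x else 0)"
    by blast
  have "\<exists>K. \<forall>i. divergence E \<rho> K i = (if i = a then x else 0) - (if i = b then x else 0)"
  proof (cases "(a, b) \<in> oriented_edges E \<and> \<rho> (a, b) = mat 1")
    case True
    then show ?thesis
      using divergence_point_mass[OF fin, of a b \<rho> x] by blast
  next
    case False
    then have "(b, a) \<in> oriented_edges E" "\<rho> (b, a) = mat 1"
      using step.hyps(2) by (auto simp: flat_edge_def)
    then show ?thesis
      \<comment> \<open>The stored edge points against the step from \<open>a\<close> to
        \<open>b\<close>; the sign compensates.\<close>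
      by (intro exI[of _ "\<lambda>e. if e = (b, a) then - x else 0"])
        (simp add: divergence_point_mass[OF fin])
  qed
  then obtain K where
    K: "\<And>i. divergence E \<rho> K i = (if i = a then x else 0) - (if i = b then x else 0)"
    by blast
  show ?case
    by (rule exI[of _ "\<lambda>e. J e + K e"]) (simp add: divergence_add J K)
qed

text \<open>Flows with divergence \<open>g a\<close> at \<open>a\<close> and \<open>- g a\<close> at
  the root are superposed. The surplus at the root is minus the total of \<open>g\<close>, hence
  zero.\<close>

lemma zero_sum_is_divergence:
  assumes "finite (oriented_edges E)" "finite V"
    and "\<And>a. a \<in> V \<Longrightarrow> (v\<^sub>0, a) \<in> {(k, l). flat_edge E \<rho> k l}\<^sup>*"
    and "(\<Sum>a\<in>V. g a) = 0"
  shows "\<exists>J. \<forall>i\<in>V. divergence E \<rho> J i = g i"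
proof -
  have "\<forall>a\<in>V. \<exists>J. \<forall>i. divergence E \<rho> J i = (if i = v\<^sub>0 then - g a else 0) - (if i = a then - g a else 0)"
    using flat_path_flow[OF assms(1)] assms(3) by blast
  then obtain J where J: "\<And>a i. a \<in> V \<Longrightarrow>
      divergence E \<rho> (J a) i = (if i = v\<^sub>0 then - g a else 0) - (if i = a then - g a else 0)"
    by (metis (no_types))
  have "divergence E \<rho> (\<lambda>e. \<Sum>a\<in>V. J a e) i = g i" if "i \<in> V" for i
  proof -
    have "divergence E \<rho> (\<lambda>e. \<Sum>a\<in>V. J a e) i
        = (\<Sum>a\<in>V. (if i = v\<^sub>0 then - g a else 0) + (if i = a then g a else 0))"
      unfolding divergence_sum by (rule sum.cong) (auto simp: J)
    also have "\<dots> = (if i = v\<^sub>0 then - (\<Sum>a\<in>V. g a) else 0) + g i"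
      using that assms(2) by (simp add: sum.distrib sum_negf)
    finally show ?thesis
      using assms(4) by simp
  qed
  then show ?thesis by blast
qed

text \<open>A single admissible flow bounds the infimum by its own cost, a real number.\<close>

lemma W1_finite_if_divergence:
  assumes "\<forall>i\<in>{1..n}. divergence E \<rho> J i = \<alpha> i - \<beta> i"
  shows "W1 n E w \<rho> \<alpha> \<beta> < \<infinity>"
proof -
  \<comment> \<open>Admissible flows are extensional; the divergence reads only values on oriented
    edges.\<close>
  let ?J = "restrict J (oriented_edges E)"
  have "divergence E \<rho> ?J i = divergence E \<rho> J i" for i
    unfolding divergence_def by (rule sum.cong) auto
  then have "?J \<in> {J \<in> vector_functions (oriented_edges E).
      \<forall>i\<in>{1..n}. incidence_mult n E \<rho> J i = \<alpha> i - \<beta> i}"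
    using assms by (simp add: vector_functions_def incidence_mult_def divergence_def)
  then have "W1 n E w \<rho> \<alpha> \<beta> \<le> ereal (\<Sum>(i, j)\<in>oriented_edges E. w i j * norm (?J (i, j)))"
    unfolding W1_def by (rule INF_lower)
  then show ?thesis
    using le_less_trans less_ereal.simps(4) by blast
qed

text \<open>Flatness of one edge determines the switching value at one endpoint from that at the
  other, and the solution is again orthogonal. Along a tree these equations never conflict, whatever
  the holonomy of \<sigma> around cycles.\<close>

lemma exists_flat_switching:
  fixes \<sigma> :: "nat \<times> nat \<Rightarrow> real ^ 'd ^ 'd"
  assumes G: "connected_weighted_graph n E w" and \<sigma>: "\<sigma> \<in> connections E"
  shows "\<exists>\<tau>\<in>switching_functions n.
           \<forall>a\<in>{1..n}. (1, a) \<in> {(k, l). flat_edge E (switched E \<tau> \<sigma>) k l}\<^sup>*"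
proof -
  define r where "r = {(k, l). {k, l} \<in> E}"
  \<comment> \<open>This is flatness after switching, expressed through the values \<open>x\<close>
    at \<open>k\<close> and \<open>y\<close> at \<open>l\<close> alone.\<close>
  define P where "P k l x y \<longleftrightarrow>
      (k, l) \<in> oriented_edges E \<and> matrix_inv x ** \<sigma> (k, l) ** y = mat 1 \<or>
      (l, k) \<in> oriented_edges E \<and> matrix_inv y ** \<sigma> (l, k) ** x = mat 1"
    for k l and x y :: "real ^ 'd ^ 'd"
  have r_sub: "r \<subseteq> {1..n} \<times> {1..n}"
    using G unfolding connected_weighted_graph_def r_def by blast
  have ext: "\<exists>y\<in>orthogonal_group. P k l x y"
    if kl: "(k, l) \<in> r" and x: "x \<in> orthogonal_group" for k l x
  proof -
    have "card {k, l} = 2"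
      using kl G unfolding connected_weighted_graph_def r_def by blast
    then have "k \<noteq> l" by auto
    then consider "(k, l) \<in> oriented_edges E" | "(l, k) \<in> oriented_edges E"
      using kl by (auto simp: r_def oriented_edges_def insert_commute neq_iff)
    then show ?thesis
    proof cases
      case 1
      then have s: "orthogonal_matrix (\<sigma> (k, l))"
        using \<sigma> by (auto simp: connections_def orthogonal_group_def)
      \<comment> \<open>The witness solves
        \<open>matrix_inv x ** \<sigma> (k, l) ** y = mat 1\<close> for \<open>y\<close>.\<close>
      have "matrix_inv x ** \<sigma> (k, l) ** (transpose (\<sigma> (k, l)) ** x)
          = transpose x ** (\<sigma> (k, l) ** transpose (\<sigma> (k, l))) ** x"
        using x by (simp add: orthogonal_matrix_matrix_inv orthogonal_group_def matrix_mul_assoc)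
      also have "\<dots> = mat 1"
        using s x by (simp add: orthogonal_matrix_def orthogonal_group_def)
      finally show ?thesis
        using 1 s x by (intro bexI[of _ "transpose (\<sigma> (k, l)) ** x"])
          (auto simp: P_def orthogonal_group_def orthogonal_matrix_mul)
    next
      case 2
      \<comment> \<open>Here \<open>y\<close> enters through its inverse, and
        \<open>y = \<sigma> (l, k) ** x\<close> solves the equation.\<close>
      then have s: "orthogonal_matrix (\<sigma> (l, k) ** x)"
        using \<sigma> x by (auto simp: connections_def orthogonal_group_def intro!: orthogonal_matrix_mul)
      then have "matrix_inv (\<sigma> (l, k) ** x) ** (\<sigma> (l, k) ** x) = mat 1"
        by (simp add: orthogonal_matrix_matrix_inv) (simp add: orthogonal_matrix_def)
      then show ?thesis
        using 2 s by (intro bexI[of _ "\<sigma> (l, k) ** x"])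
          (auto simp: P_def orthogonal_group_def matrix_mul_assoc)
    qed
  qed
  have reach: "(1, a) \<in> r\<^sup>*" if "a \<in> {1..n}" for a
    using G that unfolding connected_weighted_graph_def r_def by auto
  have "1 \<in> {1..n}"
    using G unfolding connected_weighted_graph_def by auto
  moreover have "mat 1 \<in> (orthogonal_group :: (real ^ 'd ^ 'd) set)"
    by (simp add: orthogonal_group_def orthogonal_matrix_id)
  ultimately have "\<exists>\<tau>. (\<forall>a. \<tau> a \<in> orthogonal_group) \<and>
      (\<forall>a\<in>{1..n}. (1, a) \<in> {(k, l). (k, l) \<in> r \<and> P k l (\<tau> k) (\<tau> l)}\<^sup>*)"
    by (intro gauge_along_spanning_tree r_sub reach ext) simp_all
  then obtain \<tau> where \<tau>: "\<And>a. \<tau> a \<in> orthogonal_group"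
    and path: "\<And>a. a \<in> {1..n} \<Longrightarrow> (1, a) \<in> {(k, l). (k, l) \<in> r \<and> P k l (\<tau> k) (\<tau> l)}\<^sup>*"
    by blast
  \<comment> \<open>Switching functions are extensional; all endpoints lie in \<open>{1..n}\<close>,
    so the flat edges survive the restriction.\<close>
  let ?\<tau> = "restrict \<tau> {1..n}"
  have "flat_edge E (switched E ?\<tau> \<sigma>) k l" if "(k, l) \<in> r" "P k l (\<tau> k) (\<tau> l)" for k l
    using that r_sub unfolding P_def flat_edge_def switched_def by auto
  then have "{(k, l). (k, l) \<in> r \<and> P k l (\<tau> k) (\<tau> l)} \<subseteq> {(k, l). flat_edge E (switched E ?\<tau> \<sigma>) k l}"
    by blast
  then have "\<forall>a\<in>{1..n}. (1, a) \<in> {(k, l). flat_edge E (switched E ?\<tau> \<sigma>) k l}\<^sup>*"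
    using path rtrancl_mono by blast
  moreover have "?\<tau> \<in> switching_functions n"
    using \<tau> by (simp add: switching_functions_def)
  ultimately show ?thesis by blast
qed

theorem theorem2p2:
  fixes n :: nat and E :: "nat set set" and w :: "nat \<Rightarrow> nat \<Rightarrow> real"
    and \<sigma> :: "nat \<times> nat \<Rightarrow> real ^ 'd ^ 'd"
  assumes "connected_weighted_graph n E w"
    and "\<sigma> \<in> connections E"
  shows "\<exists>\<tau>\<in>switching_functions n.
           feasible_collection n E w (switched E \<tau> \<sigma>) (vector_densities n)"
proof -
  obtain \<tau> where \<tau>: "\<tau> \<in> switching_functions n"
    and path: "\<And>a. a \<in> {1..n} \<Longrightarrow> (1, a) \<in> {(k, l). flat_edge E (switched E \<tau> \<sigma>) k l}\<^sup>*"
    using exists_flat_switching[OF assms] by blast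
  have "oriented_edges E \<subseteq> {1..n} \<times> {1..n}"
    using assms(1) unfolding connected_weighted_graph_def oriented_edges_def by blast
  then have fin: "finite (oriented_edges E)"
    by (rule finite_subset) simp
  have "W1 n E w (switched E \<tau> \<sigma>) \<alpha> \<beta> < \<infinity>"
    if "\<alpha> \<in> vector_densities n" "\<beta> \<in> vector_densities n" for \<alpha> \<beta> :: "nat \<Rightarrow> real ^ 'd"
  proof -
    \<comment> \<open>Both densities sum to the all-ones vector.\<close>
    have "(\<Sum>i\<in>{1..n}. \<alpha> i - \<beta> i) = 0"
      using that by (simp add: vector_densities_def sum_subtractf)
    from zero_sum_is_divergence[OF fin finite_atLeastAtMost path this]
    show ?thesis
      using W1_finite_if_divergence by blast
  qed
  then have "feasible_collection n E w (switched E \<tau> \<sigma>) (vector_densities n)"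
    by (auto simp: feasible_collection_def vector_densities_def)
  with \<tau> show ?thesis by blast
qed

end
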